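(* Let $r\ge 3$ be an integer and $\mathcal{A}_r=\{0,1,2^r,2^r+2\}$. Then $\phi_{\mathcal{A}_r}(x)=1+x+x^{2^r}+x^{2^r+2}$, and the sequence $\left(f_{\mathcal{A}_r}(n)\right)_{n\ge 0}$ modulo $2$ is periodic with least period dividing $4^r+2^r+1$. Among any $4^r+2^r+1$ consecutive terms of $\left(f_{\mathcal{A}_r}(n)\right)_{n\ge0}$, exactly $4^r-3^r+2^r$ terms are odd and $3^r+1$ terms are even.
   Context: For a finite set $\mathcal{A}$ of non-negative integers containing $0$, $f_{\mathcal{A}}(n)$ denotes the number of ways to write the non-negative integer $n$ in the form $n=\sum_{i=0}^{\infty}\epsilon_i2^i$ with every $\epsilon_i\in\mathcal{A}$ (so all but finitely many $\epsilon_i$ are $0$), and $\phi_{\mathcal{A}}(x)=\sum_{a\in\mathcal{A}}x^a\in\mathbb{F}_2[x]$. *)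

theory Defs
  imports "HOL-Library.Z2" "HOL-Computational_Algebra.Polynomial"
begin

text \<open>Digit sequences with only finitely many nonzero digits; these occur only if \<open>0 \<in> A\<close>.\<close>

definition representations :: "nat set \<Rightarrow> nat \<Rightarrow> (nat \<Rightarrow> nat) set" where
  "representations A n =
     {\<epsilon>. (\<forall>i. \<epsilon> i \<in> A) \<and> finite {i. \<epsilon> i \<noteq> 0} \<and> n = (\<Sum>i | \<epsilon> i \<noteq> 0. \<epsilon> i * 2 ^ i)}"

definition num_reps :: "nat set \<Rightarrow> nat \<Rightarrow> nat" where
  "num_reps A n = card (representations A n)"

text \<open>The cardinality above is a genuine count, since the set is always finite.\<close>

lemma finite_representations: "finite (representations A n)"
proof -
  have "representations A n \<subseteq>
      {\<epsilon>. \<forall>i. (i \<in> {..n} \<longrightarrow> \<epsilon> i \<in> {..n}) \<and> (i \<notin> {..n} \<longrightarrow> \<epsilon> i = 0)}"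
  proof
    fix \<epsilon> assume "\<epsilon> \<in> representations A n"
    then have fin: "finite {i. \<epsilon> i \<noteq> 0}" and n: "n = (\<Sum>i | \<epsilon> i \<noteq> 0. \<epsilon> i * 2 ^ i)"
      by (auto simp: representations_def)
    have le: "\<epsilon> i * 2 ^ i \<le> n" if "\<epsilon> i \<noteq> 0" for i
      unfolding n using that by (intro member_le_sum fin) auto
    have bound: "\<epsilon> i \<le> n \<and> i \<le> n" if "\<epsilon> i \<noteq> 0" for i
    proof -
      have "\<epsilon> i * 1 \<le> \<epsilon> i * 2 ^ i" by (intro mult_le_mono) auto
      moreover have "1 * 2 ^ i \<le> \<epsilon> i * 2 ^ i" using that by (intro mult_le_mono) auto
      moreover have "i < 2 ^ i" by simp
      ultimately show ?thesis using le[OF that] by linarith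
    qed
    have "\<epsilon> i \<le> n \<and> (\<not> i \<le> n \<longrightarrow> \<epsilon> i = 0)" for i
      using bound[of i] by (cases "\<epsilon> i = 0") auto
    then show "\<epsilon> \<in> {\<epsilon>. \<forall>i. (i \<in> {..n} \<longrightarrow> \<epsilon> i \<in> {..n}) \<and> (i \<notin> {..n} \<longrightarrow> \<epsilon> i = 0)}"
      by simp
  qed
  then show ?thesis
    by (rule finite_subset) (intro finite_set_of_finite_funs finite_atMost)
qed

text \<open>\<^typ>\<open>bit\<close> is the field with two elements.\<close>

definition phi :: "nat set \<Rightarrow> bit poly" where
  "phi A = (\<Sum>a\<in>A. monom 1 a)"

definition digits :: "nat \<Rightarrow> nat set" where
  "digits r = {0, 1, 2 ^ r, 2 ^ r + 2}"

text \<open>Pure periodicity, i.e. from index 0 on.\<close>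

definition is_period :: "(nat \<Rightarrow> 'a) \<Rightarrow> nat \<Rightarrow> bool" where
  "is_period s p \<longleftrightarrow> 0 < p \<and> (\<forall>n. s (n + p) = s n)"

definition periodic :: "(nat \<Rightarrow> 'a) \<Rightarrow> bool" where
  "periodic s \<longleftrightarrow> (\<exists>p. is_period s p)"

text \<open>Only meaningful for periodic sequences.\<close>

definition least_period :: "(nat \<Rightarrow> 'a) \<Rightarrow> nat" where
  "least_period s = (LEAST p. is_period s p)"

end

theory Submission
  imports Defs "HOL-Library.Disjoint_Sets" "HOL-Computational_Algebra.Formal_Power_Series"
begin

(* Let F be the generating function of num_reps over GF(2).  Splitting off the lowest digit gives
   F = phi F^2, so phi F = 1.  With q = 2^r and g = 1 + X^q + X^(q+1) we have phi = (1 + X) g, hence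
   1/(1 + X) + F = X^q / g is the indicator series of the n with an even count.  Since
   g (g^(q-1) + X^(q^2)) = 1 + X^(q^2+q+1) by the Frobenius identity, this series is periodic, and
   its first period is X^q (g^(q-1) + X^(q^2)).  Finally g^(q-1) is the product of the g^(2^i) for i < r, and
   expanding it yields 3^r distinct monomials. *)

(* Rewriting + and * to XOR and AND would hide the ring structure from the simplifier. *)
declare add_bit_eq_xor [simp del] mult_bit_eq_and [simp del]

section \<open>Power series over the field with two elements\<close>

lemma bit_add_self [simp]: "a + a = (0 :: bit)"
  by (cases a) simp_all

lemma of_nat_bit: "(of_nat n :: bit) = of_bool (odd n)"
  by (induction n) auto

lemma fps_bit_2_eq_0 [simp]: "2 = (0 :: bit fps)"
  by (simp add: numeral_fps_const)

lemma fps_bit_add_self [simp]: "f + f = (0 :: bit fps)"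
  by (simp flip: mult_2)

lemma CHAR_bit [simp]: "CHAR(bit) = 2"
  by (rule CHAR_eq_posI) (auto simp: less_2_cases_iff)

lemma fps_bit_add_power: "(f + g :: bit fps) ^ 2 ^ n = f ^ 2 ^ n + g ^ 2 ^ n"
  by (rule freshmans_dream') auto

text \<open>In characteristic 2 the products at \<open>k\<close> and \<open>n - k\<close> cancel in
  pairs, so only the middle one with \<open>2 * k = n\<close> can survive, and an element of GF(2)
  equals its own square. Thus squaring a series amounts to substituting X^2 for X.\<close>

lemma fps_bit_square_nth:
  fixes f :: "bit fps"
  shows "fps_nth (f\<^sup>2) n = (if even n then fps_nth f (n div 2) else 0)"
proof -
  define h where "h k = fps_nth f k * fps_nth f (n - k)" for k
  have split: "{..n} = {k. 2 * k < n} \<union> ({k. 2 * k = n} \<union> {k\<in>{..n}. n < 2 * k})"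
    by auto
  have fin: "finite {k. 2 * k < n}" "finite {k. 2 * k = n}"
    by (rule finite_subset[of _ "{..n}"]; auto)+
  have upper: "sum h {k\<in>{..n}. n < 2 * k} = sum h {k. 2 * k < n}"
    by (rule sum.reindex_bij_witness[of _ "\<lambda>k. n - k" "\<lambda>k. n - k"])
       (auto simp: h_def mult.commute)
  have mid: "sum h {k. 2 * k = n} = (if even n then fps_nth f (n div 2) else 0)"
  proof (cases "even n")
    case True
    then obtain m where n: "n = 2 * m" by blast
    then have "{k. 2 * k = n} = {m}" by auto
    moreover have "h m = fps_nth f m"
      by (cases "fps_nth f m") (simp_all add: h_def n)
    ultimately show ?thesis by (simp add: n)
  next
    case False
    then have "{k. 2 * k = n} = {}" by auto
    then show ?thesis using False by (simp only: sum.empty if_False)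
  qed
  have "fps_nth (f\<^sup>2) n = sum h {..n}"
    by (simp add: fps_square_nth h_def)
  also have "\<dots> = sum h {k. 2 * k < n}
      + (sum h {k. 2 * k = n} + sum h {k\<in>{..n}. n < 2 * k})"
    by (subst split, subst sum.union_disjoint, use fin in auto)
       (subst sum.union_disjoint, use fin in auto)
  also have "\<dots> = sum h {k. 2 * k = n} + (sum h {k. 2 * k < n} + sum h {k. 2 * k < n})"
    unfolding upper by (simp only: ac_simps)
  finally show ?thesis using mid by simp
qed

lemma fps_nth_sum_X_power:
  "finite S \<Longrightarrow> fps_nth (\<Sum>s\<in>S. fps_X ^ s) n = (of_bool (n \<in> S) :: 'a :: comm_ring_1)"
  by (simp add: fps_sum_nth)

section \<open>The generating function of the number of representations\<close>

text \<open>\<open>case_nat a \<delta>\<close> prepends the lowest digit \<open>a\<close> to the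
  digit sequence \<open>\<delta>\<close>. All other digits contribute an even amount, so
  \<open>a\<close> must have the parity of \<open>n\<close>, and the shifted remaining digits
  represent half of \<open>n - a\<close>.\<close>

lemma representations_step:
  "representations A n =
     (\<Union>a\<in>{a\<in>A. a \<le> n \<and> even (n - a)}. case_nat a ` representations A ((n - a) div 2))"
  (is "?L = ?R")
proof -
  have supp: "{i. case_nat a \<delta> i \<noteq> 0} = (if a = 0 then {} else {0}) \<union> Suc ` {i. \<delta> i \<noteq> 0}"
    for a :: nat and \<delta> :: "nat \<Rightarrow> nat"
  proof (rule set_eqI)
    fix i show "i \<in> {i. case_nat a \<delta> i \<noteq> 0} \<longleftrightarrow>
        i \<in> (if a = 0 then {} else {0}) \<union> Suc ` {i. \<delta> i \<noteq> 0}"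
      by (cases i) auto
  qed
  have fin: "finite {i. case_nat a \<delta> i \<noteq> 0} \<longleftrightarrow> finite {i. \<delta> i \<noteq> 0}"
    for a :: nat and \<delta> :: "nat \<Rightarrow> nat"
    unfolding supp by (simp add: finite_image_iff)
  have val: "(\<Sum>i | case_nat a \<delta> i \<noteq> 0. case_nat a \<delta> i * 2 ^ i)
      = a + 2 * (\<Sum>i | \<delta> i \<noteq> 0. \<delta> i * 2 ^ i)" if "finite {i. \<delta> i \<noteq> 0}"
    for a :: nat and \<delta> :: "nat \<Rightarrow> nat"
    unfolding supp using that
    by (subst sum.union_disjoint) (auto simp: sum.reindex sum_distrib_left ac_simps)
  have mem: "case_nat a \<delta> \<in> representations A n \<longleftrightarrow>
      a \<in> A \<and> a \<le> n \<and> even (n - a) \<and> \<delta> \<in> representations A ((n - a) div 2)" for a \<delta>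
  proof -
    have "(\<forall>i. case_nat a \<delta> i \<in> A) \<longleftrightarrow> a \<in> A \<and> (\<forall>i. \<delta> i \<in> A)"
      by (auto split: nat.split dest: spec[of _ 0] spec[of _ "Suc _"])
    moreover have "n = a + 2 * s \<longleftrightarrow> a \<le> n \<and> even (n - a) \<and> (n - a) div 2 = s" for s
      by auto
    ultimately show ?thesis
      unfolding representations_def mem_Collect_eq fin using val by auto
  qed
  have eta: "\<epsilon> = case_nat (\<epsilon> 0) (\<lambda>i. \<epsilon> (Suc i))" for \<epsilon> :: "nat \<Rightarrow> nat"
    by (auto simp: fun_eq_iff split: nat.split)
  show ?thesis
  proof (intro set_eqI iffI)
    fix \<epsilon> assume "\<epsilon> \<in> ?L"
    then show "\<epsilon> \<in> ?R" using mem[of "\<epsilon> 0" "\<lambda>i. \<epsilon> (Suc i)"] eta[of \<epsilon>] by auto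
  qed (use mem in auto)
qed

lemma num_reps_step:
  assumes "finite A"
  shows "num_reps A n = (\<Sum>a | a \<in> A \<and> a \<le> n \<and> even (n - a). num_reps A ((n - a) div 2))"
proof -
  \<comment> \<open>Prepending a fixed digit loses no information, and sequences with different
    prepended digits differ at index 0. Hence the cardinality of the union is the sum of the
    cardinalities.\<close>
  have inj: "inj (case_nat a :: (nat \<Rightarrow> nat) \<Rightarrow> _)" for a
    by (rule injI) (metis ext old.nat.simps(5))
  have "disjoint_family_on (\<lambda>a. case_nat a ` representations A ((n - a) div 2))
      {a\<in>A. a \<le> n \<and> even (n - a)}"
    by (auto simp: disjoint_family_on_def dest: fun_cong[of _ _ 0])
  then show ?thesis
    unfolding num_reps_def
    apply (subst representations_step)
    apply (subst card_UN_disjoint')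
    using assms by (auto simp: finite_representations card_image[OF inj_on_subset[OF inj]])
qed

lemma num_reps_0:
  assumes "0 \<in> A"
  shows "num_reps A 0 = 1"
proof -
  have "representations A 0 = {\<lambda>_. 0}"
    using assms by (auto simp: representations_def fun_eq_iff)
  then show ?thesis by (simp add: num_reps_def)
qed

definition reps_fps :: "nat set \<Rightarrow> bit fps" where
  "reps_fps A = Abs_fps (\<lambda>n. of_nat (num_reps A n))"

text \<open>Halving the remainder in the digit recursion is the substitution of X^2 for X, which
  over GF(2) is squaring by \<open>fps_bit_square_nth\<close>. Each digit \<open>a\<close>
  contributes the shift by X^a.\<close>

lemma reps_fps_step:
  assumes "finite A"
  shows "reps_fps A = (\<Sum>a\<in>A. fps_X ^ a) * (reps_fps A)\<^sup>2"
proof (rule fps_ext)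
  fix n
  have "fps_nth ((\<Sum>a\<in>A. fps_X ^ a) * (reps_fps A)\<^sup>2) n
      = (\<Sum>a\<in>A. if a \<le> n \<and> even (n - a) then of_nat (num_reps A ((n - a) div 2)) else 0)"
    unfolding sum_distrib_right fps_sum_nth
    by (intro sum.cong) (auto simp: fps_X_power_mult_nth fps_bit_square_nth reps_fps_def)
  also have "\<dots> = of_nat (num_reps A n)"
    unfolding num_reps_step[OF assms, of n] of_nat_sum
    using assms by (simp add: sum.inter_filter[symmetric])
  finally show "fps_nth (reps_fps A) n = fps_nth ((\<Sum>a\<in>A. fps_X ^ a) * (reps_fps A)\<^sup>2) n"
    by (simp add: reps_fps_def)
qed

lemma reps_fps_inverse:
  assumes "finite A" "0 \<in> A"
  shows "(\<Sum>a\<in>A. fps_X ^ a) * reps_fps A = 1"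
proof -
  have "fps_nth (reps_fps A) 0 = 1"
    using assms by (simp add: reps_fps_def num_reps_0)
  then have "reps_fps A \<noteq> 0" by auto
  moreover have "reps_fps A * ((\<Sum>a\<in>A. fps_X ^ a) * reps_fps A) = reps_fps A * 1"
    using reps_fps_step[OF assms(1)] by (simp add: power2_eq_square ac_simps)
  ultimately show ?thesis by (metis mult_left_cancel)
qed

section \<open>The monomials of powers of a trinomial\<close>

text \<open>Exponents obtained by expanding the product over i < j of 1 + X^(q 2^i) + X^((q+1) 2^i),
  picking one monomial from each factor.\<close>

fun trinomial_exps :: "nat \<Rightarrow> nat \<Rightarrow> nat set" where
  "trinomial_exps q 0 = {0}"
| "trinomial_exps q (Suc j) = trinomial_exps q j
     \<union> ((+) (q * 2 ^ j) ` trinomial_exps q j \<union> (+) ((q + 1) * 2 ^ j) ` trinomial_exps q j)"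

lemma finite_trinomial_exps [simp]: "finite (trinomial_exps q j)"
  by (induction j) auto

text \<open>The factor with index i adds (0, 0), (2^i, 0) or (2^i, 2^i) to the pair (a, b), so both
  coordinates are at most 1 + 2 + ... + 2^(j-1) = 2^j - 1.\<close>

lemma trinomial_exps_digits:
  assumes "2 ^ j \<le> q" "n \<in> trinomial_exps q j"
  obtains a b where "n = q * a + b" "a < 2 ^ j" "b < 2 ^ j"
  using assms
proof (induction j arbitrary: n thesis)
  case (Suc j)
  then have le: "2 ^ j \<le> q" by simp
  have step: ?case if mem: "m \<in> trinomial_exps q j" and n: "n = m + q * c + d" "c \<le> 2 ^ j" "d \<le> 2 ^ j"
    for m c d
  proof -
    obtain a b where "m = q * a + b" "a < 2 ^ j" "b < 2 ^ j"
      using Suc.IH[OF _ le mem] by blast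
    then show ?thesis
      using n by (intro Suc.prems(1)[of "a + c" "b + d"]) (simp_all add: algebra_simps)
  qed
  from Suc.prems(3) consider "n \<in> trinomial_exps q j"
    | m where "m \<in> trinomial_exps q j" "n = q * 2 ^ j + m"
    | m where "m \<in> trinomial_exps q j" "n = (q + 1) * 2 ^ j + m"
    by auto
  then show ?case
  proof cases
    case 1 then show ?thesis by (intro step[of n 0 0]) simp_all
  next
    case (2 m) then show ?thesis by (intro step[of m "2 ^ j" 0]) simp_all
  next
    case (3 m) then show ?thesis by (intro step[of m "2 ^ j" "2 ^ j"]) (simp_all add: algebra_simps)
  qed
qed simp

text \<open>The quotient by \<open>q\<close> separates the unshifted set from the two shifted ones,
  and the remainder separates these two from each other. The threshold is \<open>2 ^ j\<close> in
  both cases.\<close>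

lemma trinomial_exps_disjoint:
  assumes "2 ^ Suc j \<le> q"
  shows "trinomial_exps q j \<inter> (+) (q * 2 ^ j) ` trinomial_exps q j = {}"
    and "trinomial_exps q j \<inter> (+) ((q + 1) * 2 ^ j) ` trinomial_exps q j = {}"
    and "(+) (q * 2 ^ j) ` trinomial_exps q j \<inter> (+) ((q + 1) * 2 ^ j) ` trinomial_exps q j = {}"
proof -
  let ?S = "trinomial_exps q j"
  have le: "2 ^ j \<le> q" using assms by simp
  have divmod: "m div q < 2 ^ j" "m mod q < 2 ^ j"
    "(q * 2 ^ j + m) div q \<ge> 2 ^ j" "((q + 1) * 2 ^ j + m) div q \<ge> 2 ^ j"
    "(q * 2 ^ j + m) mod q < 2 ^ j" "((q + 1) * 2 ^ j + m) mod q \<ge> 2 ^ j" if m: "m \<in> ?S" for m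
  proof -
    obtain a b where ab: "m = q * a + b" "a < 2 ^ j" "b < 2 ^ j"
      using trinomial_exps_digits[OF le m] .
    \<comment> \<open>This is where \<open>2 ^ Suc j \<le> q\<close> enters: adding
      \<open>2 ^ j\<close> to the lower base-q digit \<open>b\<close> causes no carry.\<close>
    have b: "2 ^ j + b < q" and pos: "0 < q" using ab assms by simp_all
    show "m div q < 2 ^ j" "m mod q < 2 ^ j" using ab b by simp_all
    have 1: "q * 2 ^ j + m = q * (2 ^ j + a) + b"
      and 2: "(q + 1) * 2 ^ j + m = q * (2 ^ j + a) + (2 ^ j + b)"
      by (simp_all add: ab algebra_simps)
    show "(q * 2 ^ j + m) div q \<ge> 2 ^ j" "(q * 2 ^ j + m) mod q < 2 ^ j"
      unfolding 1 using b ab by simp_all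
    show "((q + 1) * 2 ^ j + m) div q \<ge> 2 ^ j" "((q + 1) * 2 ^ j + m) mod q \<ge> 2 ^ j"
      unfolding 2 using b pos by simp_all
  qed
  have disj: "A \<inter> B = {}" if "\<And>x. x \<in> A \<Longrightarrow> f x < c" "\<And>x. x \<in> B \<Longrightarrow> c \<le> f x"
    for A B :: "nat set" and f :: "nat \<Rightarrow> nat" and c
    using that by (meson disjoint_iff leD)
  show "?S \<inter> (+) (q * 2 ^ j) ` ?S = {}"
    by (rule disj[of _ "\<lambda>n. n div q" "2 ^ j"]) (use divmod in blast)+
  show "?S \<inter> (+) ((q + 1) * 2 ^ j) ` ?S = {}"
    by (rule disj[of _ "\<lambda>n. n div q" "2 ^ j"]) (use divmod in blast)+
  show "(+) (q * 2 ^ j) ` ?S \<inter> (+) ((q + 1) * 2 ^ j) ` ?S = {}"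
    by (rule disj[of _ "\<lambda>n. n mod q" "2 ^ j"]) (use divmod in blast)+
qed

lemma card_trinomial_exps: "2 ^ j \<le> q \<Longrightarrow> card (trinomial_exps q j) = 3 ^ j"
proof (induction j)
  case (Suc j)
  then have "card (trinomial_exps q j) = 3 ^ j" by simp
  then show ?case
    unfolding trinomial_exps.simps
    using trinomial_exps_disjoint[OF Suc.prems]
    by (subst card_Un_disjoint; (subst card_Un_disjoint)?) (auto simp: card_image)
qed simp

text \<open>By Frobenius the additional factor of exponent \<open>2 ^ j\<close> is again a
  trinomial. Disjointness of the three exponent sets guarantees that no monomials cancel modulo
  2.\<close>

lemma trinomial_power:
  "2 ^ j \<le> q \<Longrightarrow> (1 + fps_X ^ q + fps_X ^ (q + 1) :: bit fps) ^ (2 ^ j - 1)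
    = (\<Sum>s\<in>trinomial_exps q j. fps_X ^ s)"
proof (induction j)
  case (Suc j)
  let ?g = "1 + fps_X ^ q + fps_X ^ (q + 1) :: bit fps"
  let ?S = "trinomial_exps q j"
  have shift: "(\<Sum>s\<in>(+) c ` ?S. fps_X ^ s :: bit fps) = fps_X ^ c * (\<Sum>s\<in>?S. fps_X ^ s)" for c
    by (simp add: sum.reindex sum_distrib_left power_add)
  have "(2::nat) ^ Suc j - 1 = (2 ^ j - 1) + 2 ^ j" by simp
  then have "?g ^ (2 ^ Suc j - 1) = ?g ^ (2 ^ j - 1) * ?g ^ 2 ^ j"
    by (simp only: power_add)
  also have "\<dots> = (\<Sum>s\<in>?S. fps_X ^ s) * (1 + fps_X ^ (q * 2 ^ j) + fps_X ^ ((q + 1) * 2 ^ j))"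
    using Suc by (simp only: fps_bit_add_power power_one power_mult) simp
  also have "\<dots> = (\<Sum>s\<in>?S. fps_X ^ s)
      + ((\<Sum>s\<in>(+) (q * 2 ^ j) ` ?S. fps_X ^ s) + (\<Sum>s\<in>(+) ((q + 1) * 2 ^ j) ` ?S. fps_X ^ s))"
    unfolding shift by (simp only: distrib_left mult_1 mult_1_right ac_simps)
  also have "\<dots> = (\<Sum>s\<in>trinomial_exps q (Suc j). fps_X ^ s)"
    unfolding trinomial_exps.simps
    using trinomial_exps_disjoint[OF Suc.prems]
    by (subst sum.union_disjoint; (subst sum.union_disjoint)?) auto
  finally show ?case .
qed simp

section \<open>Parity of the number of representations\<close>

text \<open>With q = 2^r and g = 1 + X^q + X^(q+1), these are the exponents of X^q (g^(q-1) +
  X^(q^2)).\<close>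

definition even_residues :: "nat \<Rightarrow> nat set" where
  "even_residues r = (+) (2 ^ r) ` insert (4 ^ r) (trinomial_exps (2 ^ r) r)"

text \<open>For q = 2^r both base-q digits are at most q - 1, so the number is below q^2. This keeps
  the extra exponent \<open>4 ^ r\<close> distinct from the others and all of
  \<open>even_residues\<close> below the period.\<close>

lemma trinomial_exps_less:
  assumes "n \<in> trinomial_exps (2 ^ r) r"
  shows "n < 4 ^ r"
proof -
  obtain a b where ab: "n = 2 ^ r * a + b" "a < 2 ^ r" "b < 2 ^ r"
    using trinomial_exps_digits[OF order_refl assms] .
  then have "2 ^ r * (a + 1) \<le> (2 :: nat) ^ r * 2 ^ r" by (intro mult_le_mono) auto
  then show ?thesis using ab by (simp flip: power_mult_distrib)
qed

lemma card_even_residues: "card (even_residues r) = 3 ^ r + 1"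
proof -
  have "card (even_residues r) = card (insert (4 ^ r) (trinomial_exps (2 ^ r) r))"
    unfolding even_residues_def by (rule card_image) (simp only: inj_on_add)
  then show ?thesis
    using trinomial_exps_less[of "4 ^ r" r]
    by (subst (asm) card_insert_disjoint) (auto simp: card_trinomial_exps)
qed

lemma even_residues_less: "n \<in> even_residues r \<Longrightarrow> n < 4 ^ r + 2 ^ r + 1"
  by (auto simp: even_residues_def dest: trinomial_exps_less)

lemma even_reps_fps:
  assumes "r \<ge> 1"
  shows "(Abs_fps (\<lambda>_. 1) + reps_fps (digits r)) * (1 + fps_X ^ (4 ^ r + 2 ^ r + 1))
    = (\<Sum>s\<in>even_residues r. fps_X ^ s)"
proof -
  define q where "q = (2 :: nat) ^ r"
  have q: "2 \<le> q" using assms power_increasing[of 1 r "2 :: nat"] by (simp add: q_def)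
  have q2: "4 ^ r = q * q" by (simp add: q_def flip: power_mult_distrib)
  define X where "X = (fps_X :: bit fps)"
  define g where "g = 1 + X ^ q + X ^ (q + 1)"
  define E where "E = (Abs_fps (\<lambda>_. 1) :: bit fps)"
  define F where "F = reps_fps (digits r)"
  have E: "(1 + X) * E = 1"
    by (rule fps_ext) (auto simp: X_def E_def distrib_right)
  have "(\<Sum>a\<in>digits r. X ^ a) = 1 + X + X ^ q + X ^ (q + 2)"
    using q by (simp add: digits_def q_def ac_simps)
  also have "\<dots> = (1 + X) * g"
    by (simp add: g_def algebra_simps numeral_2_eq_2)
  finally have F: "(1 + X) * g * F = 1"
    using reps_fps_inverse[of "digits r"] by (simp add: F_def X_def digits_def)
  \<comment> \<open>Multiplied by 1 + X, the terms g E and g F become g and 1. Their sum g + 1 is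
    X^q + X^(q+1), from which the nonzero factor 1 + X can be cancelled.\<close>
  have "(1 + X) * (g * (E + F)) = g * ((1 + X) * E) + (1 + X) * g * F"
    by (simp only: algebra_simps)
  also have "\<dots> = (1 + X) * X ^ q"
    unfolding E F by (simp add: g_def algebra_simps)
  finally have EF: "g * (E + F) = X ^ q"
    using E by (metis mult_cancel_left mult_zero_left zero_neq_one)
  let ?H = "g ^ (q - 1) + X ^ (q * q)"
  have "g ^ q = 1 + X ^ (q * q) + X ^ (q * q + q)"
  proof -
    have "g ^ q = 1 + (X ^ q) ^ q + (X ^ (q + 1)) ^ q"
      unfolding g_def by (subst (3 5 7) q_def) (simp only: fps_bit_add_power power_one q_def)
    then show ?thesis by (simp only: power_mult[symmetric] distrib_right mult_1_left)
  qed
  moreover have "g * g ^ (q - 1) = g ^ q"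
    using q by (simp flip: power_Suc)
  \<comment> \<open>The monomials X^(q q) and X^(q q + q) of g^q cancel against the same monomials
    of g X^(q q).\<close>
  ultimately have H: "g * ?H = 1 + X ^ (q * q + q + 1)"
    by (simp add: distrib_left) (simp add: g_def algebra_simps power_add)
  have "(E + F) * (1 + X ^ (q * q + q + 1)) = g * (E + F) * ?H"
    unfolding H[symmetric] by (simp only: ac_simps)
  also have "\<dots> = X ^ q * ?H" unfolding EF ..
  also have "?H = (\<Sum>s\<in>insert (q * q) (trinomial_exps q r). X ^ s)"
  proof -
    have "q * q \<notin> trinomial_exps q r"
      using trinomial_exps_less[of "q * q" r] by (auto simp: q2 simp flip: q_def)
    then show ?thesis
      using trinomial_power[of r q] by (simp add: g_def X_def q_def add.commute)
  qed
  also have "X ^ q * \<dots> = (\<Sum>s\<in>even_residues r. X ^ s)"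
    unfolding even_residues_def q_def[symmetric] q2
    by (subst sum.reindex) (simp_all only: inj_on_add sum_distrib_left power_add o_def)
  finally show ?thesis
    by (simp only: E_def F_def X_def q2 q_def)
qed

text \<open>Comparing coefficients in \<open>even_reps_fps\<close> gives K(n) + K(n - N) =
  [n in \<open>even_residues r\<close>], the second term being absent for n < N. As all these
  residues lie below N, they fix the first N coefficients, and from N on K(n) = K(n - N).\<close>

lemma even_num_reps_iff:
  assumes "r \<ge> 1"
  shows "even (num_reps (digits r) n) \<longleftrightarrow> n mod (4 ^ r + 2 ^ r + 1) \<in> even_residues r"
proof -
  define N where "N = (4 :: nat) ^ r + 2 ^ r + 1"
  define K where "K = Abs_fps (\<lambda>_. 1) + reps_fps (digits r)"
  \<comment> \<open>Adding 1 in GF(2) turns the indicator of odd counts into that of even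
    counts.\<close>
  have K: "fps_nth K n = of_bool (even (num_reps (digits r) n))" for n
    by (simp add: K_def reps_fps_def of_nat_bit)
  have fin: "finite (even_residues r)"
    by (simp add: even_residues_def)
  have rec: "fps_nth K n + (if n < N then 0 else fps_nth K (n - N)) = of_bool (n \<in> even_residues r)"
    for n
    using arg_cong[OF even_reps_fps[OF assms, folded K_def N_def], of "\<lambda>f. fps_nth f n"]
    by (simp add: fps_nth_sum_X_power[OF fin] distrib_left fps_X_power_mult_right_nth)
  have "fps_nth K n = of_bool (n mod N \<in> even_residues r)"
  proof (induction n rule: less_induct)
    case (less n)
    show ?case
    proof (cases "n < N")
      case True
      then show ?thesis using rec[of n] by simp
    next
      case False
      then have "n \<notin> even_residues r"
        using even_residues_less by (auto simp: N_def)
      then have "fps_nth K n = fps_nth K (n - N)"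
        using rec[of n] False by (simp add: add_eq_0_iff)
      moreover have "N > 0" by (simp add: N_def)
      ultimately show ?thesis using False less[of "n - N"] by (simp add: le_mod_geq)
    qed
  qed
  then show ?thesis by (simp only: K of_bool_eq_iff N_def)
qed

section \<open>Residues in a window, divisibility by the least period, and the final count\<close>

lemma card_residues_interval:
  fixes N :: nat
  assumes "T \<subseteq> {..<N}"
  shows "card {k\<in>{m..<m + N}. k mod N \<in> T} = card T"
proof (cases "N = 0")
  case False
  have "bij_betw (\<lambda>k. k mod N) {k\<in>{m..<m + N}. k mod N \<in> T} T"
  proof (rule bij_betw_imageI)
    show "inj_on (\<lambda>k. k mod N) {k\<in>{m..<m + N}. k mod N \<in> T}"
    proof (rule linorder_inj_onI')
      fix i j assume ij: "i \<in> {k\<in>{m..<m + N}. k mod N \<in> T}"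
        "j \<in> {k\<in>{m..<m + N}. k mod N \<in> T}" "i < j"
      show "i mod N \<noteq> j mod N"
      proof
        assume "i mod N = j mod N"
        then have "N dvd j - i" using ij(3) by (metis mod_eq_dvd_iff_nat less_imp_le)
        then show False using ij by (auto dest!: dvd_imp_le)
      qed
    qed
    have "t \<in> (\<lambda>k. k mod N) ` {k\<in>{m..<m + N}. k mod N \<in> T}" if t: "t \<in> T" for t
    \<comment> \<open>The window begins at offset \<open>m mod N\<close> of a block of length
      \<open>N\<close>. A residue from that offset on is attained in the same block, a smaller one
      in the next block.\<close>
    proof (cases "m mod N \<le> t")
      case True
      let ?k = "N * (m div N) + t"
      have "t < N" using t assms by auto
      moreover have "m = N * (m div N) + m mod N" by simp
      ultimately have "?k \<in> {m..<m + N}" "?k mod N = t"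
        using True by (simp_all, linarith+)
      then show ?thesis using t by force
    next
      case False
      let ?k = "N * (m div N + 1) + t"
      have "t < N" using t assms by auto
      moreover have "m = N * (m div N) + m mod N" "m mod N < N" using \<open>N \<noteq> 0\<close> by simp_all
      ultimately have "?k \<in> {m..<m + N}"
        using False unfolding distrib_left mult_1_right atLeastLessThan_iff by linarith
      moreover have "?k mod N = t"
        using \<open>t < N\<close> by (subst add.commute, subst mod_mult_self2) simp
      ultimately have "?k \<in> {m..<m + N}" "?k mod N = t" .
      then show ?thesis using t by force
    qed
    then show "(\<lambda>k. k mod N) ` {k\<in>{m..<m + N}. k mod N \<in> T} = T" by blast
  qed
  then show ?thesis by (rule bij_betw_same_card)
qed (use assms in auto)

lemma least_period_dvd:
  assumes "is_period s p"
  shows "least_period s dvd p"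
proof -
  define l where "l = least_period s"
  have l: "is_period s l"
    using assms unfolding l_def least_period_def by (rule LeastI)
  have mult: "s (n + l * k) = s n" for n k
  proof (induction k)
    case (Suc k)
    have "s (n + l * Suc k) = s (n + l * k + l)" by (simp add: ac_simps)
    then show ?case using l Suc by (simp only: is_period_def)
  qed simp
  \<comment> \<open>Since \<open>p mod l\<close> differs from \<open>p\<close> by a multiple of
    \<open>l\<close>, it shifts the sequence trivially. If nonzero it would be a period smaller than
    the least one.\<close>
  have "s (n + p mod l) = s n" for n
  proof -
    have "s (n + p mod l) = s (n + p mod l + l * (p div l))" by (simp only: mult)
    also have "n + p mod l + l * (p div l) = n + p" by simp
    finally show ?thesis using assms by (simp add: is_period_def)
  qed
  then have "p mod l > 0 \<Longrightarrow> is_period s (p mod l)" by (simp add: is_period_def)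
  moreover have "p mod l < l" using l by (simp add: is_period_def)
  ultimately have "p mod l = 0"
    unfolding l_def least_period_def using not_less_Least[of _ "is_period s"] by blast
  then show ?thesis by (simp add: l_def mod_eq_0_iff_dvd)
qed

theorem mainTheorem8:
  fixes r :: nat
  assumes "r \<ge> 3"
  shows "phi (digits r) = 1 + monom 1 1 + monom 1 (2 ^ r) + monom 1 (2 ^ r + 2)
    \<and> periodic (\<lambda>n. num_reps (digits r) n mod 2)
    \<and> least_period (\<lambda>n. num_reps (digits r) n mod 2) dvd 4 ^ r + 2 ^ r + 1
    \<and> (\<forall>m. card {k \<in> {m..<m + (4 ^ r + 2 ^ r + 1)}. odd (num_reps (digits r) k)}
              = 4 ^ r - 3 ^ r + 2 ^ r
          \<and> card {k \<in> {m..<m + (4 ^ r + 2 ^ r + 1)}. even (num_reps (digits r) k)}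
              = 3 ^ r + 1)"
proof -
  define N where "N = (4 :: nat) ^ r + 2 ^ r + 1"
  have even_iff: "even (num_reps (digits r) n) \<longleftrightarrow> n mod N \<in> even_residues r" for n
    using even_num_reps_iff[of r n] assms by (simp add: N_def)
  \<comment> \<open>The bound makes the four digits pairwise distinct, so the sum over the set has
    four terms.\<close>
  have "(2 :: nat) ^ r \<ge> 2" using assms power_increasing[of 1 r "2 :: nat"] by simp
  then have phi: "phi (digits r) = 1 + monom 1 1 + monom 1 (2 ^ r) + monom 1 (2 ^ r + 2)"
    by (simp add: phi_def digits_def ac_simps)
  have period: "is_period (\<lambda>n. num_reps (digits r) n mod 2) N"
    unfolding is_period_def mod2_eq_if even_iff mod_add_self2 by (simp add: N_def)
  have card_even: "card {k\<in>{m..<m + N}. even (num_reps (digits r) k)} = 3 ^ r + 1" for m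
    unfolding even_iff
    using card_residues_interval[of "even_residues r" N m] even_residues_less[of _ r]
    by (auto simp: card_even_residues N_def)
  have card_odd: "card {k\<in>{m..<m + N}. odd (num_reps (digits r) k)} = 4 ^ r - 3 ^ r + 2 ^ r" for m
  proof -
    have odd_eq: "{k\<in>{m..<m + N}. odd (num_reps (digits r) k)}
        = {m..<m + N} - {k\<in>{m..<m + N}. even (num_reps (digits r) k)}" by auto
    have "card {k\<in>{m..<m + N}. odd (num_reps (digits r) k)}
        = card {m..<m + N} - card {k\<in>{m..<m + N}. even (num_reps (digits r) k)}"
      unfolding odd_eq by (rule card_Diff_subset) auto
    then have "card {k\<in>{m..<m + N}. odd (num_reps (digits r) k)} = N - (3 ^ r + 1)"
      by (simp only: card_even card_atLeastLessThan diff_add_inverse)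
    \<comment> \<open>Subtraction on \<open>nat\<close> is truncated, so this is needed to rewrite
      \<open>N - (3 ^ r + 1)\<close> as \<open>4 ^ r - 3 ^ r + 2 ^ r\<close>.\<close>
    moreover have "(3 :: nat) ^ r \<le> 4 ^ r" by (rule power_mono) auto
    ultimately show ?thesis by (simp add: N_def)
  qed
  show ?thesis
    unfolding N_def[symmetric] periodic_def
    using phi period least_period_dvd[OF period] card_even card_odd by (intro conjI allI exI)
qed

end
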